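(* For all $x\in\mathbb{B}$ and $y\in\mathbb{S}$, $$P_k(x,y)=-d_k\,\langle y,\nabla_yG_k(x,y)\rangle .$$
   Context: Let $R\subset\mathbb{R}^d$ be a (reduced) root system, not necessarily crystallographic and not necessarily spanning $\mathbb{R}^d$; $W$ is the finite group generated by the reflections $\sigma_\alpha$, $\alpha\in R$; $R_+$ is a positive subsystem; $k:R\to[0,\infty)$ is $W$-invariant. Put $\gamma=\sum_{\alpha\in R_+}k(\alpha)$ and $\omega_k(x)=\prod_{\alpha\in R_+}|\langle\alpha,x\rangle|^{2k(\alpha)}$. It is assumed throughout that $d+2\gamma>2$. Dunkl operators: $T_\xi f(x)=\partial_\xi f(x)+\sum_{\alpha\in R_+}k(\alpha)\langle\alpha,\xi\rangle\frac{f(x)-f(\sigma_\alpha x)}{\langle\alpha,x\rangle}$. The intertwining operator $V_k$ is the unique linear isomorphism of the space of polynomials on $\mathbb{R}^d$ preserving the degree of homogeneity with $V_k(1)=1$ and $T_\xi V_k=V_k\partial_\xi$ for all $\xi$. For $x\in\mathbb{R}^d$, $C(x)$ is the convex hull of the orbit $W.x$, and $\mu_x=\mu_x^k$ is the probability measure on $C(x)$ with $V_kf(x)=\int_{C(x)}f\,d\mu_x$ for all polynomials $f$. $\mathbb{B}=\{|x|<1\}$, $\mathbb{S}=\partial\mathbb{B}$, $\sigma$ is the surface measure on $\mathbb{S}$ (counting measure if $d=1$), $d_k=\int_{\mathbb{S}}\omega_k\,d\sigma$, $C_k=\frac{1}{d_k(d+2\gamma-2)}$. The Poisson kernel of $\mathbb{B}$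 for the Dunkl Laplacian $\Delta_k=\sum_iT_{e_i}^2$ is $P_k(x,y)=\int_{C(y)}\frac{1-|x|^2}{(1-2\langle x,z\rangle+|x|^2)^{\gamma+d/2}}\,d\mu_y(z)$ for $x\in\mathbb{B}$, $y\in\mathbb{S}$. The Green function of $\mathbb{B}$ for $\Delta_k$ is given by $$G_k(x,y)=C_k\int_{C(y)}\Bigl[(|x|^2+|y|^2-2\langle x,z\rangle)^{1-\gamma-d/2}-(1+|x|^2|y|^2-2\langle x,z\rangle)^{1-\gamma-d/2}\Bigr]d\mu_y(z).$$ For fixed $x\in\mathbb{B}$ this expression makes sense for $y$ in a neighbourhood of $\mathbb{S}$, and $\nabla_yG_k(x,y)$ at $y\in\mathbb{S}$ is its gradient with respect to $y$. *)

theory Defs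
  imports "HOL-Analysis.Analysis" "HOL-Probability.Probability"
begin

definition reflection :: "'a::euclidean_space \<Rightarrow> 'a \<Rightarrow> 'a" where
  "reflection \<alpha> x = x - (2 * (\<alpha> \<bullet> x) / (\<alpha> \<bullet> \<alpha>)) *\<^sub>R \<alpha>"

definition root_system :: "'a::euclidean_space set \<Rightarrow> bool" where
  "root_system R \<longleftrightarrow>
     finite R \<and> 0 \<notin> R \<and>
     (\<forall>\<alpha>\<in>R. R \<inter> span {\<alpha>} = {\<alpha>, - \<alpha>}) \<and>
     (\<forall>\<alpha>\<in>R. reflection \<alpha> ` R = R)"

definition positive_subsystem :: "'a::euclidean_space set \<Rightarrow> 'a set \<Rightarrow> bool" where
  "positive_subsystem R Rp \<longleftrightarrow>
     (\<exists>\<beta>. (\<forall>\<alpha>\<in>R. \<alpha> \<bullet> \<beta> \<noteq> 0) \<and> Rp = {\<alpha>\<in>R. \<alpha> \<bullet> \<beta> > 0})"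

text \<open>Reflections are involutions, so closing under composition alone already gives
  the group they generate.\<close>

inductive_set reflection_group :: "'a::euclidean_space set \<Rightarrow> ('a \<Rightarrow> 'a) set"
  for R :: "'a set" where
  "id \<in> reflection_group R"
| "\<alpha> \<in> R \<Longrightarrow> g \<in> reflection_group R \<Longrightarrow> reflection \<alpha> \<circ> g \<in> reflection_group R"

definition multiplicity_function :: "'a::euclidean_space set \<Rightarrow> ('a \<Rightarrow> real) \<Rightarrow> bool" where
  "multiplicity_function R k \<longleftrightarrow>
     (\<forall>\<alpha>\<in>R. k \<alpha> \<ge> 0) \<and> (\<forall>g\<in>reflection_group R. \<forall>\<alpha>\<in>R. k (g \<alpha>) = k \<alpha>)"

definition dunkl_gamma :: "'a::euclidean_space set \<Rightarrow> ('a \<Rightarrow> real) \<Rightarrow> real" where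
  "dunkl_gamma Rp k = (\<Sum>\<alpha>\<in>Rp. k \<alpha>)"

text \<open>The case distinction enforces the convention that the zeroth power of 0 is 1,
  whereas \<^term>\<open>0 powr 0 = (0::real)\<close>.\<close>

definition dunkl_weight :: "'a::euclidean_space set \<Rightarrow> ('a \<Rightarrow> real) \<Rightarrow> 'a \<Rightarrow> real" where
  "dunkl_weight Rp k x =
     (\<Prod>\<alpha>\<in>Rp. if k \<alpha> = 0 then 1 else \<bar>\<alpha> \<bullet> x\<bar> powr (2 * k \<alpha>))"

definition dir_deriv :: "'a::euclidean_space \<Rightarrow> ('a \<Rightarrow> real) \<Rightarrow> 'a \<Rightarrow> real" where
  "dir_deriv \<xi> f x = frechet_derivative f (at x) \<xi>"

text \<open>For a polynomial \<open>f\<close> the quotient \<open>(f x - f (\<sigma>\<^sub>\<alpha> x)) / \<langle>\<alpha>, x\<rangle>\<close> is a polynomial in \<open>x\<close>.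
  Since \<open>\<sigma>\<^sub>\<alpha> x = x - (2 \<langle>\<alpha>, x\<rangle> / |\<alpha>|^2) \<alpha>\<close>, its value on the hyperplane \<open>\<langle>\<alpha>, x\<rangle> = 0\<close> is
  \<open>2 / |\<alpha>|^2\<close> times the derivative of \<open>f\<close> at \<open>x\<close> in direction \<open>\<alpha>\<close>; it has to be prescribed
  because division by zero yields 0.\<close>

definition dunkl_quotient :: "'a::euclidean_space \<Rightarrow> ('a \<Rightarrow> real) \<Rightarrow> 'a \<Rightarrow> real" where
  "dunkl_quotient \<alpha> f x =
     (if \<alpha> \<bullet> x = 0 then 2 / (\<alpha> \<bullet> \<alpha>) * dir_deriv \<alpha> f x
      else (f x - f (reflection \<alpha> x)) / (\<alpha> \<bullet> x))"

definition dunkl_operator ::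
  "'a::euclidean_space set \<Rightarrow> ('a \<Rightarrow> real) \<Rightarrow> 'a \<Rightarrow> ('a \<Rightarrow> real) \<Rightarrow> 'a \<Rightarrow> real" where
  "dunkl_operator Rp k \<xi> f x =
     dir_deriv \<xi> f x + (\<Sum>\<alpha>\<in>Rp. k \<alpha> * (\<alpha> \<bullet> \<xi>) * dunkl_quotient \<alpha> f x)"

definition polynomials :: "('a::euclidean_space \<Rightarrow> real) set" where
  "polynomials = {f. real_polynomial_function f}"

definition homogeneous_polynomials :: "nat \<Rightarrow> ('a::euclidean_space \<Rightarrow> real) set" where
  "homogeneous_polynomials n =
     {f \<in> polynomials. \<forall>t x. f (t *\<^sub>R x) = t ^ n * f x}"

text \<open>These properties determine \<open>V\<close> uniquely on polynomials; its values on other functions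
  are irrelevant.\<close>

definition intertwining_operator ::
  "'a::euclidean_space set \<Rightarrow> ('a \<Rightarrow> real) \<Rightarrow> (('a \<Rightarrow> real) \<Rightarrow> 'a \<Rightarrow> real) \<Rightarrow> bool" where
  "intertwining_operator Rp k V \<longleftrightarrow>
     bij_betw V polynomials polynomials \<and>
     (\<forall>f\<in>polynomials. \<forall>g\<in>polynomials. V (\<lambda>x. f x + g x) = (\<lambda>x. V f x + V g x)) \<and>
     (\<forall>c. \<forall>f\<in>polynomials. V (\<lambda>x. c * f x) = (\<lambda>x. c * V f x)) \<and>
     (\<forall>n. \<forall>f\<in>homogeneous_polynomials n. V f \<in> homogeneous_polynomials n) \<and>
     V (\<lambda>x. 1) = (\<lambda>x. 1) \<and>
     (\<forall>\<xi>. \<forall>f\<in>polynomials. dunkl_operator Rp k \<xi> (V f) = V (dir_deriv \<xi> f))"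

definition orbit_hull :: "'a::euclidean_space set \<Rightarrow> 'a \<Rightarrow> 'a set" where
  "orbit_hull R x = convex hull ((\<lambda>g. g x) ` reflection_group R)"

text \<open>The space of \<open>\<mu> x\<close> is \<open>orbit_hull R x\<close>, so integrals with respect to \<open>\<mu> x\<close> are
  integrals over \<open>orbit_hull R x\<close>.\<close>

definition representing_measures ::
  "'a::euclidean_space set \<Rightarrow> (('a \<Rightarrow> real) \<Rightarrow> 'a \<Rightarrow> real) \<Rightarrow> ('a \<Rightarrow> 'a measure) \<Rightarrow> bool" where
  "representing_measures R V \<mu> \<longleftrightarrow>
     (\<forall>x. prob_space (\<mu> x) \<and>
          sets (\<mu> x) = sets (restrict_space borel (orbit_hull R x)) \<and>
          (\<forall>f\<in>polynomials. V f x = (\<integral>z. f z \<partial>\<mu> x)))"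

text \<open>Surface measure of the unit sphere: \<open>\<sigma>(A) = d \<lambda>{t a | 0 < t < 1, a \<in> A}\<close>. In dimension
  one this is the counting measure on the two unit vectors.\<close>

definition sphere_measure :: "'a::euclidean_space measure" where
  "sphere_measure =
     scale_measure (of_nat DIM('a))
       (distr (restrict_space lborel (ball 0 1 - {0})) (restrict_space borel (sphere 0 1)) sgn)"

definition dunkl_d :: "'a::euclidean_space set \<Rightarrow> ('a \<Rightarrow> real) \<Rightarrow> real" where
  "dunkl_d Rp k = (\<integral>x. dunkl_weight Rp k x \<partial>sphere_measure)"

definition dunkl_C :: "'a::euclidean_space set \<Rightarrow> ('a \<Rightarrow> real) \<Rightarrow> real" where
  "dunkl_C Rp k = 1 / (dunkl_d Rp k * (real DIM('a) + 2 * dunkl_gamma Rp k - 2))"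

definition dunkl_poisson ::
  "'a::euclidean_space set \<Rightarrow> ('a \<Rightarrow> real) \<Rightarrow> ('a \<Rightarrow> 'a measure) \<Rightarrow> 'a \<Rightarrow> 'a \<Rightarrow> real" where
  "dunkl_poisson Rp k \<mu> x y =
     (\<integral>z. (1 - (norm x)\<^sup>2) /
          (1 - 2 * (x \<bullet> z) + (norm x)\<^sup>2) powr (dunkl_gamma Rp k + real DIM('a) / 2) \<partial>\<mu> y)"

definition dunkl_green ::
  "'a::euclidean_space set \<Rightarrow> ('a \<Rightarrow> real) \<Rightarrow> ('a \<Rightarrow> 'a measure) \<Rightarrow> 'a \<Rightarrow> 'a \<Rightarrow> real" where
  "dunkl_green Rp k \<mu> x y =
     dunkl_C Rp k *
     (\<integral>z. ((norm x)\<^sup>2 + (norm y)\<^sup>2 - 2 * (x \<bullet> z)) powr (1 - dunkl_gamma Rp k - real DIM('a) / 2) -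
          (1 + (norm x)\<^sup>2 * (norm y)\<^sup>2 - 2 * (x \<bullet> z)) powr (1 - dunkl_gamma Rp k - real DIM('a) / 2)
        \<partial>\<mu> y)"

end

theory Submission
  imports Defs "HOL-Complex_Analysis.Cauchy_Integral_Formula"
begin

text \<open>
  Put \<open>p = 1 - \<gamma> - d/2 < 0\<close> and \<open>u = -2x\<close>. Both terms of the Green function integrate a power
  \<open>(B(y) + \<langle>u, z\<rangle>)\<^sup>p\<close> against \<open>\<mu>\<^sub>y\<close>, where \<open>B(y)\<close> is \<open>|x|\<^sup>2 + |y|\<^sup>2\<close> or \<open>1 + |x|\<^sup>2|y|\<^sup>2\<close>. For
  \<open>y\<close> close to the sphere \<open>|u||y| < B(y)\<close>, and the support of \<open>\<mu>\<^sub>y\<close> lies in the ball of radius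
  \<open>|y|\<close>, so the binomial series may be integrated term by term. The moments of \<open>\<mu>\<^sub>y\<close> that occur,
  \<open>M\<^sub>n(y) = \<integral> \<langle>u, z\<rangle>\<^sup>n d\<mu>\<^sub>y(z)\<close>, are the values of \<open>V\<^sub>k\<close> on \<open>\<langle>u, .\<rangle>\<^sup>n\<close> and hence homogeneous
  polynomials of degree \<open>n\<close> in \<open>y\<close>. By homogeneity the integral is
  \<open>B(y)\<^sup>p h\<^sub>p(y / B(y))\<close> with \<open>h\<^sub>p = \<Sum>\<^sub>n binom(p, n) M\<^sub>n\<close> (lemma \<open>integral_kernel\<close>).

  No differentiable dependence of \<open>\<mu>\<^sub>y\<close> on \<open>y\<close> is at hand, so differentiability of the Green
  function has to come from the polynomials. One has \<open>|M\<^sub>n(v)| \<le> (|u||v|)\<^sup>n\<close>, and a weak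
  Markov inequality, with a factor polynomial in the degree, turns this into a bound for the
  derivatives of \<open>M\<^sub>n\<close> on a slightly smaller ball. This suffices to differentiate the series term
  by term where \<open>|u||v| < 1\<close> (lemma \<open>homogeneous_series_has_derivative\<close>). Euler's identity for
  \<open>M\<^sub>n\<close> and \<open>(p - n) binom(p, n) = p binom(p - 1, n)\<close> then give the radial derivative
  \<open>\<langle>v, \<nabla>h\<^sub>p(v)\<rangle> = p h\<^sub>p(v) - p h\<^sub>p\<^sub>-\<^sub>1(v)\<close> (lemma \<open>intertwined_power_has_derivative\<close>).

  On the sphere both functions \<open>B\<close> take the value \<open>A = 1 + |x|\<^sup>2\<close>, so the two terms of the Green
  function are evaluated at the same point \<open>v = y / A\<close>; their radial derivatives differ only because
  those of the functions \<open>B\<close> are \<open>2\<close> and \<open>2|x|\<^sup>2\<close>. The difference is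
  \<open>2(1 - |x|\<^sup>2) A\<^sup>p\<^sup>-\<^sup>1 (p h\<^sub>p(v) - \<langle>v, \<nabla>h\<^sub>p(v)\<rangle>) = 2p (1 - |x|\<^sup>2) A\<^sup>p\<^sup>-\<^sup>1 h\<^sub>p\<^sub>-\<^sub>1(v)\<close>,
  and \<open>(1 - |x|\<^sup>2) A\<^sup>p\<^sup>-\<^sup>1 h\<^sub>p\<^sub>-\<^sub>1(v)\<close> is the Poisson kernel, whose exponent is \<open>p - 1\<close>. The constants
  match because \<open>C\<^sub>k = -1 / (2p d\<^sub>k)\<close>, which requires \<open>0 < d\<^sub>k < \<infinity>\<close> (lemma \<open>dunkl_d_pos\<close>).
\<close>

section \<open>A weak Markov inequality\<close>

text \<open>Cauchy's estimate at the origin.\<close>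

lemma coeff_le_of_unit_circle_bound:
  fixes Q :: "complex poly"
  assumes "\<And>z. norm z = 1 \<Longrightarrow> norm (poly Q z) \<le> B"
  shows "norm (coeff Q j) \<le> B"
proof -
  have "(deriv ^^ j) (poly Q) = poly ((pderiv ^^ j) Q)"
    by (induction j) (auto intro!: DERIV_imp_deriv poly_DERIV)
  moreover have "norm ((deriv ^^ j) (poly Q) 0) \<le> fact j * B / 1 ^ j"
    using assms by (intro Cauchy_inequality) (auto intro!: holomorphic_intros continuous_intros)
  ultimately show ?thesis
    by (simp add: poly_0_coeff_0 coeff_higher_pderiv norm_mult flip: pochhammer_fact)
qed

lemma poly_eq_sum_atMost:
  fixes p :: "'a::comm_semiring_1 poly"
  assumes "degree p \<le> n"
  shows "poly p x = (\<Sum>i\<le>n. coeff p i * x ^ i)"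
  unfolding poly_altdef using assms
  by (intro sum.mono_neutral_left) (auto simp: coeff_eq_0)

text \<open>A bound of polynomial growth in \<open>n\<close> is all that is needed, which makes the following crude argument
  enough. Substituting \<open>t = sin s\<close> and \<open>z = e\<^sup>i\<^sup>s\<close> turns \<open>p\<close> into \<open>z\<^sup>-\<^sup>n Q(z)\<close> on the unit circle, with
  a polynomial \<open>Q\<close> of degree at most \<open>2n\<close> that is again bounded by \<open>B\<close> there. So are its
  coefficients, which bounds \<open>Q'(1)\<close>, and \<open>p'(0)\<close> can be read off from \<open>Q'(1)\<close> because \<open>s = 0\<close>
  corresponds to \<open>z = 1\<close>.\<close>

lemma poly_deriv_at_0_bound:
  fixes p :: "real poly"
  assumes deg: "degree p \<le> n" and bd: "\<And>t. \<bar>t\<bar> \<le> 1 \<Longrightarrow> \<bar>poly p t\<bar> \<le> B"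
  shows "\<bar>poly (pderiv p) 0\<bar> \<le> 2 * real n * (real n + 1) * B"
proof -
  define P where "P = map_poly complex_of_real p"
  define Q where "Q = (\<Sum>i\<le>n. smult (coeff P i / (2 * \<i>) ^ i) (monom 1 (n - i) * [:-1, 0, 1:] ^ i))"
  have degP: "degree P \<le> n"
    using deg by (intro degree_le) (simp add: P_def coeff_map_poly coeff_eq_0)
  have Preal: "poly P (of_real t) = of_real (poly p t)" for t
    unfolding poly_eq_sum_atMost[OF degP] poly_eq_sum_atMost[OF deg] by (simp add: P_def coeff_map_poly)
  have Qz: "poly Q z = z ^ n * poly P ((z - 1 / z) / (2 * \<i>))" if "z \<noteq> 0" for z
  proof -
    have "poly P ((z - 1 / z) / (2 * \<i>)) = (\<Sum>i\<le>n. coeff P i * ((z - 1 / z) / (2 * \<i>)) ^ i)"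
      using degP by (rule poly_eq_sum_atMost)
    moreover have "z ^ n * (c * ((z - 1 / z) / (2 * \<i>)) ^ i) =
        c / (2 * \<i>) ^ i * (z ^ (n - i) * (z\<^sup>2 - 1) ^ i)" if "i \<le> n" for c i
    proof -
      have "z ^ n = z ^ (n - i) * z ^ i"
        using that by (simp flip: power_add)
      moreover have "((z - 1 / z) / (2 * \<i>)) ^ i = (z - 1 / z) ^ i / (2 * \<i>) ^ i"
        by (rule power_divide)
      moreover have "z ^ i * (z - 1 / z) ^ i = (z\<^sup>2 - 1) ^ i"
        using \<open>z \<noteq> 0\<close> by (simp add: field_simps power2_eq_square flip: power_mult_distrib)
      moreover have "a * b * (c * (X / Y)) = c / Y * (a * (b * X))" for a b X Y :: complex
        by simp
      ultimately show ?thesis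
        by presburger
    qed
    ultimately show ?thesis
      by (simp add: Q_def poly_sum poly_monom sum_distrib_left power2_eq_square mult.commute)
  qed
  have degQ: "degree Q \<le> 2 * n"
  proof (unfold Q_def, intro degree_sum_le)
    fix i assume "i \<in> {..n}"
    have "degree (monom 1 (n - i) * [:-1, 0, 1:] ^ i :: complex poly) \<le>
        (n - i) + i * 2"
      by (rule order.trans[OF degree_mult_le]) (simp add: degree_monom_eq degree_power_eq)
    also have "\<dots> \<le> 2 * n"
      using \<open>i \<in> {..n}\<close> by simp
    finally show "degree (smult (coeff P i / (2 * \<i>) ^ i) (monom 1 (n - i) * [:-1, 0, 1:] ^ i)) \<le> 2 * n"
      using degree_smult_le order.trans by blast
  qed simp
  \<comment> \<open>On the circle \<open>(z - 1/z) / (2\<i>)\<close> is the imaginary part of \<open>z\<close>, a point of \<open>[-1, 1]\<close>.\<close>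
  have circle: "norm (poly Q z) \<le> B" if "norm z = 1" for z
  proof -
    have "z \<noteq> 0" "1 / z = cnj z"
      using that by (auto simp: divide_eq_eq complex_norm_square[symmetric] mult.commute)
    moreover have "(z - cnj z) / (2 * \<i>) = complex_of_real (Im z)"
      by (simp add: complex_eq_iff)
    ultimately have "norm (poly Q z) = \<bar>poly p (Im z)\<bar>"
      using that by (simp add: Qz Preal norm_mult norm_power)
    then show ?thesis
      using bd[of "Im z"] abs_Im_le_cmod[of z] that by simp
  qed
  have dQ: "norm (poly (pderiv Q) 1) \<le> n * (2 * n + 1) * B"
  proof -
    have "B \<ge> 0"
      using bd[of 0] by simp
    have "poly (pderiv Q) 1 = (\<Sum>j<2*n. coeff (pderiv Q) j)"
    proof (cases "n = 0")
      case True
      then show ?thesis using degQ by (metis degree_0_id lessThan_0 mult_0_right pderiv_0 pderiv_pCons poly_0 sum.empty le_zero_eq pderiv_eq_0_iff)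
    next
      case False
      then have "degree (pderiv Q) \<le> 2 * n - 1" using degQ by (simp add: degree_pderiv)
      from poly_eq_sum_atMost[OF this, of 1] show ?thesis using False
        by (simp add: lessThan_Suc_atMost[symmetric])
    qed
    also have "norm \<dots> \<le> (\<Sum>j<2*n. real (Suc j) * B)"
      using coeff_le_of_unit_circle_bound[OF circle]
      by (intro sum_norm_le) (simp add: coeff_pderiv norm_mult mult_left_mono del: of_nat_Suc)
    also have "\<dots> = n * (2 * n + 1) * B"
    proof -
      have "(\<Sum>j<m. real (Suc j)) = m * (m + 1) / 2" for m :: nat
        by (induction m) (auto simp: field_simps)
      from this[of "2 * n"] show ?thesis
        by (simp flip: sum_distrib_right)
    qed
    finally show ?thesis .
  qed
  have "poly (pderiv Q) 1 = n * coeff P 0 + coeff P 1 / \<i>"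
  proof (rule DERIV_unique)
    have "((\<lambda>z. z ^ n * poly P ((z - 1 / z) / (2 * \<i>))) has_field_derivative
        n * coeff P 0 + coeff P 1 / \<i>) (at 1)"
      by (auto intro!: derivative_eq_intros poly_DERIV[THEN DERIV_chain2] 
          simp: poly_0_coeff_0 coeff_pderiv)
    then show "(poly Q has_field_derivative n * coeff P 0 + coeff P 1 / \<i>) (at 1)"
      
    proof (rule has_field_derivative_transform_within[where d = 1])
      show "z ^ n * poly P ((z - 1 / z) / (2 * \<i>)) = poly Q z" if "dist z 1 < 1" for z
        using that by (subst Qz) auto
    qed auto
    show "(poly Q has_field_derivative poly (pderiv Q) 1) (at 1)"
      by (rule poly_DERIV)
  qed
  then have "of_real (coeff p 1) = (poly (pderiv Q) 1 - n * of_real (coeff p 0)) * \<i>"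
    by (simp add: P_def coeff_map_poly complex_eq_iff)
  then have "\<bar>coeff p 1\<bar> = norm ((poly (pderiv Q) 1 - n * of_real (coeff p 0)) * \<i>)"
    by (metis norm_of_real)
  also have "\<dots> \<le> norm (poly (pderiv Q) 1) + n * \<bar>coeff p 0\<bar>"
    unfolding norm_mult by (simp, rule order.trans[OF norm_triangle_ineq4]) (simp add: norm_mult)
  also have "\<dots> \<le> n * (2 * n + 1) * B + n * B"
    using dQ bd[of 0] by (intro add_mono mult_left_mono) (auto simp: poly_0_coeff_0)
  finally show ?thesis
    by (simp add: poly_0_coeff_0 coeff_pderiv algebra_simps)
qed

section \<open>Series of homogeneous polynomials\<close>

lemma real_polynomial_function_on_line:
  fixes f :: "'a::euclidean_space \<Rightarrow> real"
  assumes "real_polynomial_function f"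
  obtains p where "\<And>t. f (a + t *\<^sub>R b) = poly p t"
proof -
  have "real_polynomial_function (\<lambda>t. f (a + t *\<^sub>R b))"
    using assms
  proof (induction)
    case (linear f)
    then have "f (a + t *\<^sub>R b) = f a + t * f b" for t
      by (simp add: linear_simps)
    then show ?case
      by (simp add: real_polynomial_function.intros bounded_linear_mult_left)
  qed (auto intro: real_polynomial_function.intros)
  then obtain c N where "(\<lambda>t. f (a + t *\<^sub>R b)) = (\<lambda>t. \<Sum>i\<le>N. c i * t ^ i)"
    using real_polynomial_function_iff_sum by blast
  then have "f (a + t *\<^sub>R b) = poly (\<Sum>i\<le>N. monom (c i) i) t" for t
    by (simp add: poly_sum poly_monom fun_eq_iff)
  then show ?thesis by (rule that)
qed

text \<open>Homogeneity exchanges the roles of the two vectors: for \<open>t \<noteq> 0\<close>,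
  \<open>f(a + tb) = t\<^sup>n f(b + t\<^sup>-\<^sup>1 a) = t\<^sup>n q(t\<^sup>-\<^sup>1)\<close> with a polynomial \<open>q\<close>. Multiplying by \<open>t\<close> to the degree
  of \<open>q\<close> gives an identity of polynomials in which \<open>q\<close> appears reflected, and the degrees can be
  compared.\<close>

lemma homogeneous_on_line_degree_le:
  fixes f :: "'a::euclidean_space \<Rightarrow> real"
  assumes f: "real_polynomial_function f" and hom: "\<And>t x. f (t *\<^sub>R x) = t ^ n * f x"
    and p: "\<And>t. f (a + t *\<^sub>R b) = poly p t"
  shows "degree p \<le> n"
proof (cases "p = 0")
  case False
  obtain q where q: "\<And>s. f (b + s *\<^sub>R a) = poly q s"
    using real_polynomial_function_on_line[OF f] by metis
  \<comment> \<open>The extra factor \<open>t\<close> on both sides makes the identity hold at \<open>t = 0\<close> as well.\<close>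
  have "monom 1 (Suc (degree q)) * p = monom 1 (Suc n) * reflect_poly q"
  proof (rule poly_ext)
    fix t :: real
    show "poly (monom 1 (Suc (degree q)) * p) t = poly (monom 1 (Suc n) * reflect_poly q) t"
    proof (cases "t = 0")
      case False
      then have "a + t *\<^sub>R b = t *\<^sub>R (b + inverse t *\<^sub>R a)"
        by (simp add: scaleR_add_right)
      then have "poly p t = t ^ n * poly q (inverse t)"
        by (metis hom p q)
      with False show ?thesis
        by (simp add: poly_monom poly_reflect_poly_nz)
    qed (simp add: poly_monom)
  qed
  then have "Suc (degree q) + degree p = degree (monom 1 (Suc n) * reflect_poly q)"
    using False by (metis degree_monom_eq degree_mult_eq monom_eq_0_iff zero_neq_one)
  also have "\<dots> \<le> Suc n + degree q"
    using degree_mult_le[of "monom 1 (Suc n)" "reflect_poly q"] degree_reflect_poly_le[of q]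
    by (simp add: degree_monom_eq)
  finally show ?thesis by simp
qed simp


lemma has_field_derivative_along_line:
  fixes f :: "'a::real_normed_vector \<Rightarrow> real"
  assumes "(f has_derivative f') (at (a + s *\<^sub>R b))"
  shows "((\<lambda>t. f (a + t *\<^sub>R b)) has_field_derivative f' b) (at s)"
proof -
  have "((\<lambda>t. a + t *\<^sub>R b) has_derivative (\<lambda>t. t *\<^sub>R b)) (at s)"
    by (auto intro!: derivative_eq_intros)
  from has_derivative_compose[OF this assms]
  have "((\<lambda>t. f (a + t *\<^sub>R b)) has_derivative (\<lambda>t. f' (t *\<^sub>R b))) (at s)" .
  moreover have "f' (t *\<^sub>R b) = f' b * t" for t
    using linear_cmul[OF has_derivative_linear[OF assms], of t b] by simp
  ultimately show ?thesis
    by (simp add: has_field_derivative_def)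
qed

text \<open>On the segment of half-length \<open>\<delta>\<close> through \<open>v\<close> in direction \<open>h\<close> the polynomial has degree at most \<open>n\<close>
  and stays below \<open>(L(r + \<delta>))\<^sup>n\<close>, so the weak Markov inequality applies after rescaling.\<close>

lemma homogeneous_deriv_bound:
  fixes f :: "'a::euclidean_space \<Rightarrow> real"
  assumes f: "real_polynomial_function f" and hom: "\<And>t x. f (t *\<^sub>R x) = t ^ n * f x"
    and bd: "\<And>v. \<bar>f v\<bar> \<le> (L * norm v) ^ n" and "L \<ge> 0"
    and f': "(f has_derivative f') (at v)" and v: "norm v \<le> r" and "\<delta> > 0"
  shows "\<bar>f' h\<bar> \<le> 2 * real n * (real n + 1) * (L * (r + \<delta>)) ^ n / \<delta> * norm h"
proof (cases "h = 0")
  case True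
  then show ?thesis
    using linear_0[OF has_derivative_linear[OF f']] by simp
next
  case False
  define s where "s = \<delta> / norm h"
  have s: "s > 0" "s * norm h = \<delta>"
    using False \<open>\<delta> > 0\<close> by (auto simp: s_def)
  obtain p where p: "\<And>t. f (v + t *\<^sub>R (s *\<^sub>R h)) = poly p t"
    using real_polynomial_function_on_line[OF f] by metis
  have "\<bar>poly (pderiv p) 0\<bar> \<le> 2 * real n * (real n + 1) * (L * (r + \<delta>)) ^ n"
  proof (rule poly_deriv_at_0_bound)
    show "degree p \<le> n"
      using f hom p by (rule homogeneous_on_line_degree_le)
    show "\<bar>poly p t\<bar> \<le> (L * (r + \<delta>)) ^ n" if "\<bar>t\<bar> \<le> 1" for t
    proof -
      have "norm (v + t *\<^sub>R (s *\<^sub>R h)) \<le> norm v + \<bar>t\<bar> * (s * norm h)"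
        using s(1) by (intro norm_triangle_le) (simp add: abs_mult)
      also have "\<dots> \<le> r + \<delta>"
        using v that \<open>\<delta> > 0\<close> by (simp add: s(2) add_mono mult_left_le_one_le)
      finally have "L * norm (v + t *\<^sub>R (s *\<^sub>R h)) \<le> L * (r + \<delta>)"
        using \<open>L \<ge> 0\<close> by (rule mult_left_mono)
      then show ?thesis
        using bd[of "v + t *\<^sub>R (s *\<^sub>R h)"] \<open>L \<ge> 0\<close>
        by (metis mult_nonneg_nonneg norm_ge_zero order.trans p power_mono)
    qed
  qed
  moreover have "poly (pderiv p) 0 = f' (s *\<^sub>R h)"
  proof (rule DERIV_unique)
    show "(poly p has_field_derivative poly (pderiv p) 0) (at 0)"
      by (rule poly_DERIV)
    show "(poly p has_field_derivative f' (s *\<^sub>R h)) (at 0)"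
      using has_field_derivative_along_line[of f f' v 0 "s *\<^sub>R h"] f' unfolding p by simp
  qed
  moreover have "f' (s *\<^sub>R h) = s * f' h"
    using linear_cmul[OF has_derivative_linear[OF f'], of s h] by simp
  ultimately have "s * \<bar>f' h\<bar> \<le> 2 * real n * (real n + 1) * (L * (r + \<delta>)) ^ n"
    using s(1) by (simp add: abs_mult)
  then have "\<bar>f' h\<bar> \<le> 2 * real n * (real n + 1) * (L * (r + \<delta>)) ^ n / s"
    using s(1) by (simp add: pos_le_divide_eq mult.commute)
  then show ?thesis
    by (simp add: s_def)
qed

lemma euler_homogeneous:
  fixes f :: "'a::real_normed_vector \<Rightarrow> real"
  assumes hom: "\<And>t x. f (t *\<^sub>R x) = t ^ n * f x" and f': "(f has_derivative f') (at v)"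
  shows "f' v = n * f v"
proof (rule DERIV_unique)
  show "((\<lambda>t. t ^ n * f v) has_field_derivative f' v) (at 1)"
    using has_field_derivative_along_line[of f f' 0 1 v] f' by (simp add: hom)
  show "((\<lambda>t. t ^ n * f v) has_field_derivative n * f v) (at 1)"
    by (auto intro!: derivative_eq_intros)
qed

lemma summable_power_series_times_index:
  fixes c :: "nat \<Rightarrow> real"
  assumes "\<And>q. \<bar>q\<bar> < 1 \<Longrightarrow> summable (\<lambda>n. c n * q ^ n)" and "\<bar>q\<bar> < 1"
  shows "summable (\<lambda>n. (n * c n) * q ^ n)"
proof -
  have "summable (\<lambda>n. diffs c n * q ^ n * q)"
    using termdiff_converges[of q 1 c] assms by (intro summable_mult2) auto
  then have "summable (\<lambda>n. (Suc n * c (Suc n)) * q ^ Suc n)"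
    by (simp add: diffs_def mult_ac del: of_nat_Suc)
  then show ?thesis
    by (subst (asm) summable_Suc_iff)
qed

lemma summable_abs_power_series:
  fixes c :: "nat \<Rightarrow> real"
  assumes c: "\<And>q. \<bar>q\<bar> < 1 \<Longrightarrow> summable (\<lambda>n. c n * q ^ n)" and q: "\<bar>q\<bar> < 1"
  shows "summable (\<lambda>n. \<bar>c n\<bar> * q ^ n)"
proof -
  obtain q' where "\<bar>q\<bar> < q'" "q' < 1"
    using q dense by blast
  then have "summable (\<lambda>n. norm (c n * q ^ n))"
    by (intro powser_insidea[OF c[of q']]) auto
  then show ?thesis
    by (intro summable_norm_cancel[of "\<lambda>n. \<bar>c n\<bar> * q ^ n"]) (simp add: abs_mult)
qed

text \<open>Choosing \<open>norm v < r < \<rho>\<close> with \<open>L \<rho> < 1\<close>, the derivatives of the terms on the ball of radius \<open>r\<close> are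
  dominated by \<open>\<bar>c n\<bar>\<close> times a polynomial in \<open>n\<close> times \<open>(L \<rho>)\<^sup>n\<close>, which is summable because polynomial
  factors do not change the radius of convergence. Hence the series may be differentiated term by
  term, and the value of the derivative in the radial direction \<open>v\<close> comes from Euler's identity.\<close>

lemma homogeneous_series_has_derivative:
  fixes f :: "nat \<Rightarrow> 'a::euclidean_space \<Rightarrow> real" and c :: "nat \<Rightarrow> real"
  assumes f: "\<And>n. real_polynomial_function (f n)"
    and hom: "\<And>n t x. f n (t *\<^sub>R x) = t ^ n * f n x"
    and bd: "\<And>n v. \<bar>f n v\<bar> \<le> (L * norm v) ^ n" and "L \<ge> 0"
    and c: "\<And>q. \<bar>q\<bar> < 1 \<Longrightarrow> summable (\<lambda>n. c n * q ^ n)"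
    and v: "L * norm v < 1"
  obtains h' where "((\<lambda>w. \<Sum>n. c n * f n w) has_derivative h') (at v)"
    and "(\<lambda>n. c n * (n * f n v)) sums h' v"
proof -
  obtain \<rho> where \<rho>: "norm v < \<rho>" "L * \<rho> < 1"
  proof (cases "L = 0")
    case True
    then show ?thesis using that[of "norm v + 1"] by simp
  next
    case False
    then have "norm v < 1 / L"
      using v \<open>L \<ge> 0\<close> by (simp add: field_simps)
    then obtain \<rho> where "norm v < \<rho>" "\<rho> < 1 / L"
      using dense by blast
    then show ?thesis
      using that[of \<rho>] False \<open>L \<ge> 0\<close> by (simp add: field_simps)
  qed
  obtain r where r: "norm v < r" "r < \<rho>"
    using \<rho>(1) dense by blast
  define \<theta> where "\<theta> = L * \<rho>"
  have "\<rho> > 0"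
    using \<rho>(1) norm_ge_zero[of v] by linarith
  then have \<theta>: "0 \<le> \<theta>" "\<theta> < 1"
    using \<rho> \<open>L \<ge> 0\<close> by (auto simp: \<theta>_def)
  define df where "df n w = frechet_derivative (f n) (at w)" for n w
  have df: "(f n has_derivative df n w) (at w)" for n w
    using differentiable_at_real_polynomial_function[OF f] 
    by (simp add: df_def frechet_derivative_works[symmetric])
  define b where "b n = \<bar>c n\<bar> * (2 * real n * (real n + 1) * \<theta> ^ n / (\<rho> - r))" for n
  have bound: "\<bar>c n * df n w h\<bar> \<le> b n * norm h" if "w \<in> ball 0 r" for n w h
  proof -
    have "\<bar>df n w h\<bar> \<le> 2 * real n * (real n + 1) * (L * (r + (\<rho> - r))) ^ n / (\<rho> - r) * norm h"
      using that r by (intro homogeneous_deriv_bound[OF f hom bd \<open>L \<ge> 0\<close> df]) auto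
    from mult_left_mono[OF this, of "\<bar>c n\<bar>"] show ?thesis
      by (simp add: abs_mult b_def \<theta>_def mult_ac)
  qed
  have "summable b"
  proof -
    note c1 = summable_abs_power_series[OF c]
    note c2 = summable_power_series_times_index[OF c1]
    note c3 = summable_power_series_times_index[OF c2]
    have "summable (\<lambda>n. 2 / (\<rho> - r) * ((n * (n * \<bar>c n\<bar>)) * \<theta> ^ n + (n * \<bar>c n\<bar>) * \<theta> ^ n))"
      using \<theta> by (intro summable_mult summable_add c2 c3) auto
    then show ?thesis
      by (simp add: b_def[abs_def] algebra_simps add_divide_distrib)
  qed
  have df_summable: "summable (\<lambda>n. c n * df n w h)" if "w \<in> ball 0 r" for w h
    using bound[OF that] by (intro summable_comparison_test'[OF summable_mult2[OF \<open>summable b\<close>]]) auto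
  define G where "G w h = (\<Sum>n. c n * df n w h)" for w h
  have tail: "\<bar>(\<Sum>i<n. c i * df i w h) - G w h\<bar> \<le> (\<Sum>i. b (i + n)) * norm h"
    if w: "w \<in> ball 0 r" for n w h
  proof -
    have "G w h - (\<Sum>i<n. c i * df i w h) = (\<Sum>i. c (i + n) * df (i + n) w h)"
      unfolding G_def by (rule suminf_minus_initial_segment[symmetric, OF df_summable[OF w]])
    also have "norm \<dots> \<le> (\<Sum>i. b (i + n) * norm h)"
      using bound[OF w] \<open>summable b\<close>
      by (intro norm_suminf_le summable_mult2 summable_ignore_initial_segment) auto
    also have "\<dots> = (\<Sum>i. b (i + n)) * norm h"
      using \<open>summable b\<close> by (intro suminf_mult2[symmetric] summable_ignore_initial_segment)
    finally show ?thesis by (simp add: abs_minus_commute)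
  qed
  have tail_0: "(\<lambda>n. \<Sum>i. b (i + n)) \<longlonglongrightarrow> 0"
    using \<open>summable b\<close> by (rule suminf_exist_split2)
  have v_r: "v \<in> ball 0 r"
    using r by simp
  have "\<exists>g. \<forall>w\<in>ball 0 r. (\<lambda>n. c n * f n w) sums g w \<and> (g has_derivative G w) (at w within ball 0 r)"
  proof (rule has_derivative_series[where f' = "\<lambda>n w h. c n * df n w h" and x = 0])
    show "convex (ball (0::'a) r)"
      by (rule convex_ball)
    show "((\<lambda>w. c n * f n w) has_derivative (\<lambda>h. c n * df n w h)) (at w within ball 0 r)" for n w
      by (rule has_derivative_at_withinI[OF has_derivative_mult_right[OF df]])
    show "\<forall>\<^sub>F n in sequentially. \<forall>w\<in>ball 0 r. \<forall>h. norm ((\<Sum>i<n. c i * df i w h) - G w h) \<le> e * norm h"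
      if "e > 0" for e
      using order_tendstoD(2)[OF tail_0 that]
    proof eventually_elim
      case (elim n)
      show ?case
      proof (intro ballI allI)
        fix w h assume w: "w \<in> ball (0::'a) r"
        have "\<bar>(\<Sum>i<n. c i * df i w h) - G w h\<bar> \<le> (\<Sum>i. b (i + n)) * norm h"
          using w by (rule tail)
        also have "\<dots> \<le> e * norm h"
          using elim by (intro mult_right_mono) auto
        finally show "norm ((\<Sum>i<n. c i * df i w h) - G w h) \<le> e * norm h"
          by simp
      qed
    qed
    show "0 \<in> ball (0::'a) r"
      using le_less_trans[OF norm_ge_zero r(1)] by simp
    have "c n * f n 0 = 0" if "n \<notin> {0}" for n
    proof -
      have "f n 0 = 0 ^ n * f n 0"
        using hom[of n 0 0] by (simp only: scaleR_zero_left)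
      also have "\<dots> = 0"
        using that by (simp add: power_0_left)
      finally show ?thesis by simp
    qed
    then show "(\<lambda>n. c n * f n 0) sums (\<Sum>n\<in>{0}. c n * f n 0)"
      by (intro sums_finite) auto
  qed
  then obtain g where g: "\<And>w. w \<in> ball 0 r \<Longrightarrow> (\<lambda>n. c n * f n w) sums g w"
    and g': "(g has_derivative G v) (at v within ball 0 r)"
    using v_r by blast
  have "((\<lambda>w. \<Sum>n. c n * f n w) has_derivative G v) (at v)"
  proof (rule has_derivative_transform_within_open[where s = "ball 0 r" and f = g])
    show "(g has_derivative G v) (at v)"
      using g' unfolding at_within_open[OF v_r open_ball] .
    show "open (ball (0::'a) r)"
      by (rule open_ball)
    show "v \<in> ball 0 r"
      by (rule v_r)
    show "g w = (\<Sum>n. c n * f n w)" if "w \<in> ball 0 r" for w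
      using g[OF that] by (rule sums_unique)
  qed
  moreover have "(\<lambda>n. c n * (n * f n v)) sums G v v"
  proof -
    have "df n v v = n * f n v" for n
      using hom df by (rule euler_homogeneous)
    then show ?thesis
      using summable_sums[OF df_summable[OF v_r, of v]] by (simp add: G_def)
  qed
  ultimately show ?thesis by (rule that)
qed

section \<open>Integrating the binomial series\<close>

lemma norm_reflection: "norm (reflection \<alpha> x) = norm x"
proof (cases "\<alpha> = 0")
  case False
  define c where "c = 2 * (\<alpha> \<bullet> x) / (\<alpha> \<bullet> \<alpha>)"
  have "c * (\<alpha> \<bullet> \<alpha>) = 2 * (\<alpha> \<bullet> x)"
    using False by (simp add: c_def)
  then have "(x - c *\<^sub>R \<alpha>) \<bullet> (x - c *\<^sub>R \<alpha>) = x \<bullet> x"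
    by (simp add: inner_diff_left inner_diff_right inner_commute algebra_simps)
  then show ?thesis
    by (simp add: reflection_def c_def norm_eq_sqrt_inner)
qed (simp add: reflection_def)

lemma norm_reflection_group: "g \<in> reflection_group R \<Longrightarrow> norm (g x) = norm x"
  by (induction rule: reflection_group.induct) (auto simp: norm_reflection)

lemma orbit_hull_subset_cball: "orbit_hull R x \<subseteq> cball 0 (norm x)"
  unfolding orbit_hull_def
  by (intro hull_minimal) (auto simp: norm_reflection_group)

lemma sums_integral_dominated:
  fixes f :: "nat \<Rightarrow> 'a \<Rightarrow> real"
  assumes "prob_space N" and meas [measurable]: "\<And>n. f n \<in> borel_measurable N"
    and bd: "\<And>n z. z \<in> space N \<Longrightarrow> \<bar>f n z\<bar> \<le> b n" and "summable b"
    and sums: "\<And>z. z \<in> space N \<Longrightarrow> (\<lambda>n. f n z) sums g z"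
  shows "integrable N g" and "(\<lambda>n. \<integral>z. f n z \<partial>N) sums (\<integral>z. g z \<partial>N)"
proof -
  interpret N: prob_space N by fact
  have int: "integrable N (f n)" for n
    using bd by (intro N.integrable_const_bound[of _ "b n"]) (auto intro!: AE_I2)
  have bd_int: "(\<integral>z. norm (f n z) \<partial>N) \<le> b n" for n
    using N.integral_le_const[of "\<lambda>z. norm (f n z)" "b n"] int bd by (auto intro!: AE_I2)
  have 1: "AE z in N. summable (\<lambda>n. norm (f n z))"
    using bd by (intro AE_I2 summable_comparison_test'[OF \<open>summable b\<close>]) auto
  have 2: "summable (\<lambda>n. \<integral>z. norm (f n z) \<partial>N)"
    using bd_int by (intro summable_comparison_test'[OF \<open>summable b\<close>]) auto
  have g: "g z = (\<Sum>n. f n z)" if "z \<in> space N" for z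
    using sums[OF that] by (rule sums_unique)
  show "integrable N g"
    using integrable_suminf[OF int 1 2] g by (simp cong: Bochner_Integration.integrable_cong)
  show "(\<lambda>n. \<integral>z. f n z \<partial>N) sums (\<integral>z. g z \<partial>N)"
    using sums_integral[OF int 1 2] g by (simp cong: Bochner_Integration.integral_cong)
qed

lemma summable_abs_binomial_series:
  fixes p q :: real
  assumes "\<bar>q\<bar> < 1"
  shows "summable (\<lambda>n. \<bar>p gchoose n\<bar> * q ^ n)"
  by (intro summable_abs_power_series sums_summable[OF gen_binomial_real] assms)

lemma abs_inner_power_le: "\<bar>(u \<bullet> z) ^ n\<bar> \<le> (norm u * r) ^ n" if "norm z \<le> r"
proof -
  have "\<bar>u \<bullet> z\<bar> \<le> norm u * r"
    using Cauchy_Schwarz_ineq2[of u z] that by (meson mult_left_mono norm_ge_zero order.trans)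
  then show ?thesis
    by (simp add: power_abs power_mono)
qed

lemma integral_inner_binomial:
  fixes u :: "'a::euclidean_space"
  assumes "prob_space N" and sets: "sets N = sets (restrict_space borel S)"
    and S: "S \<subseteq> cball 0 r" and r: "norm u * r < 1" "r \<ge> 0"
  shows "integrable N (\<lambda>z. (1 + u \<bullet> z) powr p)"
    and "(\<lambda>n. (p gchoose n) * (\<integral>z. (u \<bullet> z) ^ n \<partial>N)) sums (\<integral>z. (1 + u \<bullet> z) powr p \<partial>N)"
proof -
  have space: "space N = S"
    using sets_eq_imp_space_eq[OF sets] by (simp add: space_restrict_space)
  have [measurable]: "(\<lambda>z. (p gchoose n) * (u \<bullet> z) ^ n) \<in> borel_measurable N" for n
    by (subst measurable_cong_sets[OF sets refl]) (intro measurable_restrict_space1, measurable)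
  have nz: "norm z \<le> r" if "z \<in> space N" for z
    using that S by (auto simp: space)
  have bd: "\<bar>(p gchoose n) * (u \<bullet> z) ^ n\<bar> \<le> \<bar>p gchoose n\<bar> * (norm u * r) ^ n"
    if "z \<in> space N" for n z
    unfolding abs_mult by (intro mult_left_mono abs_inner_power_le nz that) auto
  have sums: "(\<lambda>n. (p gchoose n) * (u \<bullet> z) ^ n) sums (1 + u \<bullet> z) powr p" if "z \<in> space N" for z
    using abs_inner_power_le[OF nz[OF that], of u 1] r by (intro gen_binomial_real) simp
  have b: "summable (\<lambda>n. \<bar>p gchoose n\<bar> * (norm u * r) ^ n)"
    using r by (intro summable_abs_binomial_series) auto
  note dom = sums_integral_dominated[OF \<open>prob_space N\<close> _ bd b sums]
  show "integrable N (\<lambda>z. (1 + u \<bullet> z) powr p)"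
    by (rule dom) auto
  have "(\<lambda>n. \<integral>z. (p gchoose n) * (u \<bullet> z) ^ n \<partial>N) sums (\<integral>z. (1 + u \<bullet> z) powr p \<partial>N)"
    by (rule dom) auto
  then show "(\<lambda>n. (p gchoose n) * (\<integral>z. (u \<bullet> z) ^ n \<partial>N)) sums (\<integral>z. (1 + u \<bullet> z) powr p \<partial>N)"
    by simp
qed

section \<open>The intertwining operator on powers of linear forms\<close>

lemma real_polynomial_function_inner_power: "real_polynomial_function (\<lambda>z. (u \<bullet> z) ^ n)"
  by (intro real_polynomial_function_power real_polynomial_function.intros(1) bounded_linear_inner_right)

lemma moment_homogeneous:
  assumes "intertwining_operator Rp k V"
  shows "real_polynomial_function (V (\<lambda>z. (u \<bullet> z) ^ n))"
    and "V (\<lambda>z. (u \<bullet> z) ^ n) (t *\<^sub>R v) = t ^ n * V (\<lambda>z. (u \<bullet> z) ^ n) v"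
proof -
  have "(\<lambda>z. (u \<bullet> z) ^ n) \<in> homogeneous_polynomials n"
    by (simp add: homogeneous_polynomials_def polynomials_def real_polynomial_function_inner_power
        power_mult_distrib)
  then have "V (\<lambda>z. (u \<bullet> z) ^ n) \<in> homogeneous_polynomials n"
    using assms by (simp add: intertwining_operator_def)
  then show "real_polynomial_function (V (\<lambda>z. (u \<bullet> z) ^ n))"
    and "V (\<lambda>z. (u \<bullet> z) ^ n) (t *\<^sub>R v) = t ^ n * V (\<lambda>z. (u \<bullet> z) ^ n) v"
    by (auto simp: homogeneous_polynomials_def polynomials_def)
qed

lemma moment_eq_integral:
  assumes "representing_measures R V \<mu>"
  shows "V (\<lambda>z. (u \<bullet> z) ^ n) w = (\<integral>z. (u \<bullet> z) ^ n \<partial>\<mu> w)"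
  using assms
  by (simp add: representing_measures_def polynomials_def real_polynomial_function_inner_power)

lemma moment_bound:
  fixes u w :: "'a::euclidean_space"
  assumes "representing_measures R V \<mu>"
  shows "\<bar>V (\<lambda>z. (u \<bullet> z) ^ n) w\<bar> \<le> (norm u * norm w) ^ n"
proof -
  interpret prob_space "\<mu> w"
    using assms by (simp add: representing_measures_def)
  have sets: "sets (\<mu> w) = sets (restrict_space borel (orbit_hull R w))"
    using assms by (simp add: representing_measures_def)
  have bd: "\<bar>(u \<bullet> z) ^ n\<bar> \<le> (norm u * norm w) ^ n" if "z \<in> space (\<mu> w)" for z
    using that orbit_hull_subset_cball[of R w] sets_eq_imp_space_eq[OF sets]
    by (intro abs_inner_power_le) (auto simp: space_restrict_space)
  have "integrable (\<mu> w) (\<lambda>z. (u \<bullet> z) ^ n)"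
  proof (rule integrable_const_bound)
    show "AE z in \<mu> w. norm ((u \<bullet> z) ^ n) \<le> (norm u * norm w) ^ n"
      using bd by (intro AE_I2) simp
    show "(\<lambda>z. (u \<bullet> z) ^ n) \<in> borel_measurable (\<mu> w)"
      by (subst measurable_cong_sets[OF sets refl]) (intro measurable_restrict_space1, measurable)
  qed
  then have "(\<integral>z. \<bar>(u \<bullet> z) ^ n\<bar> \<partial>\<mu> w) \<le> (norm u * norm w) ^ n"
    using bd by (intro integral_le_const) (auto intro!: AE_I2)
  then show ?thesis
    unfolding moment_eq_integral[OF assms] by (rule order.trans[OF integral_abs_bound])
qed

text \<open>This is \<open>V\<close> applied to \<open>z \<mapsto> (1 + \<langle>u, z\<rangle>)\<^sup>p\<close>, in general no polynomial; hence the definition by the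
  binomial series.\<close>

definition intertwined_power ::
  "(('a::euclidean_space \<Rightarrow> real) \<Rightarrow> 'a \<Rightarrow> real) \<Rightarrow> 'a \<Rightarrow> real \<Rightarrow> 'a \<Rightarrow> real" where
  "intertwined_power V u p v = (\<Sum>n. (p gchoose n) * V (\<lambda>z. (u \<bullet> z) ^ n) v)"

lemma intertwined_power_sums:
  assumes "representing_measures R V \<mu>" and "norm u * norm v < 1"
  shows "(\<lambda>n. (p gchoose n) * V (\<lambda>z. (u \<bullet> z) ^ n) v) sums intertwined_power V u p v"
  unfolding intertwined_power_def
proof (intro summable_sums summable_comparison_test'[OF summable_abs_binomial_series[of _ p]])
  show "\<bar>norm u * norm v\<bar> < 1"
    using assms(2) by simp
  show "norm ((p gchoose n) * V (\<lambda>z. (u \<bullet> z) ^ n) v) \<le> \<bar>p gchoose n\<bar> * (norm u * norm v) ^ n" for n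
    using moment_bound[OF assms(1), of u n v] by (simp add: abs_mult mult_left_mono)
qed

text \<open>The number \<open>A\<close> is pulled out of the power so that the binomial series applies to
  \<open>1 + \<langle>u / A, z\<rangle>\<close>; the factor \<open>A\<^sup>-\<^sup>n\<close> of the \<open>n\<close>th moment is then moved into the argument \<open>w\<close> by
  homogeneity. On the right-hand side the measure has disappeared, so the dependence on \<open>w\<close> is that of one fixed
  function \<open>intertwined_power V u p\<close>, even if \<open>A\<close> is chosen depending on \<open>w\<close>.\<close>

lemma integral_kernel:
  fixes u w :: "'a::euclidean_space"
  assumes V: "intertwining_operator Rp k V" and \<mu>: "representing_measures R V \<mu>"
    and A: "norm u * norm w < A"
  shows "integrable (\<mu> w) (\<lambda>z. (A + u \<bullet> z) powr p)"
    and "(\<integral>z. (A + u \<bullet> z) powr p \<partial>\<mu> w) = A powr p * intertwined_power V u p ((1 / A) *\<^sub>R w)"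
proof -
  have "A > 0"
    using A by (smt (verit) norm_ge_zero mult_nonneg_nonneg)
  define u' where "u' = (1 / A) *\<^sub>R u"
  have prob: "prob_space (\<mu> w)" and sets: "sets (\<mu> w) = sets (restrict_space borel (orbit_hull R w))"
    using \<mu> by (simp_all add: representing_measures_def)
  have u': "norm u' * norm w < 1" "norm u * norm ((1 / A) *\<^sub>R w) < 1"
    using A \<open>A > 0\<close> by (simp_all add: u'_def field_simps)
  note binom = integral_inner_binomial[OF prob sets orbit_hull_subset_cball u'(1) norm_ge_zero, of p]
  have eq: "(A + u \<bullet> z) powr p = A powr p * (1 + u' \<bullet> z) powr p" if "z \<in> space (\<mu> w)" for z
  proof -
    have "norm z \<le> norm w"
      using that orbit_hull_subset_cball[of R w] sets_eq_imp_space_eq[OF sets]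
      by (auto simp: space_restrict_space)
    then have "\<bar>u' \<bullet> z\<bar> < 1"
      using abs_inner_power_le[of z "norm w" u' 1] u' by simp
    then have "A powr p * (1 + u' \<bullet> z) powr p = (A * (1 + u' \<bullet> z)) powr p"
      using \<open>A > 0\<close> by (simp add: powr_mult)
    also have "A * (1 + u' \<bullet> z) = A + u \<bullet> z"
      using \<open>A > 0\<close> by (simp add: u'_def field_simps)
    finally show ?thesis ..
  qed
  show "integrable (\<mu> w) (\<lambda>z. (A + u \<bullet> z) powr p)"
    using binom(1) by (simp add: eq cong: Bochner_Integration.integrable_cong)
  have "(\<integral>z. (u' \<bullet> z) ^ n \<partial>\<mu> w) = V (\<lambda>z. (u \<bullet> z) ^ n) ((1 / A) *\<^sub>R w)" for n
  proof -
    have "(\<integral>z. (u' \<bullet> z) ^ n \<partial>\<mu> w) = (1 / A) ^ n * (\<integral>z. (u \<bullet> z) ^ n \<partial>\<mu> w)"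
      by (simp add: u'_def power_mult_distrib power_divide)
    then show ?thesis
      by (simp only: moment_eq_integral[OF \<mu>, symmetric] moment_homogeneous(2)[OF V])
  qed
  then have "(\<integral>z. (1 + u' \<bullet> z) powr p \<partial>\<mu> w) = intertwined_power V u p ((1 / A) *\<^sub>R w)"
    using sums_unique2[OF binom(2)] intertwined_power_sums[OF \<mu> u'(2)] by simp
  moreover have "(\<integral>z. (A + u \<bullet> z) powr p \<partial>\<mu> w) = (\<integral>z. A powr p * (1 + u' \<bullet> z) powr p \<partial>\<mu> w)"
    by (intro Bochner_Integration.integral_cong eq refl)
  ultimately show "(\<integral>z. (A + u \<bullet> z) powr p \<partial>\<mu> w) = A powr p * intertwined_power V u p ((1 / A) *\<^sub>R w)"
    by simp
qed

text \<open>For a function of one variable \<open>s\<close> the second equation is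
  \<open>s d/ds (1 + s)\<^sup>p = p (1 + s)\<^sup>p - p (1 + s)\<^sup>p\<^sup>-\<^sup>1\<close>. Replacing \<open>s\<^sup>n\<close>
  by the \<open>n\<close>th moment preserves this identity of power series: by homogeneity the radial derivative
  multiplies the \<open>n\<close>th moment by \<open>n\<close>, just as \<open>s d/ds\<close> does with \<open>s\<^sup>n\<close>.\<close>

lemma intertwined_power_has_derivative:
  fixes u v :: "'a::euclidean_space"
  assumes V: "intertwining_operator Rp k V" and \<mu>: "representing_measures R V \<mu>"
    and uv: "norm u * norm v < 1"
  obtains h' where "(intertwined_power V u p has_derivative h') (at v)"
    and "h' v = p * intertwined_power V u p v - p * intertwined_power V u (p - 1) v"
proof -
  obtain h' where h': "((\<lambda>w. \<Sum>n. (p gchoose n) * V (\<lambda>z. (u \<bullet> z) ^ n) w) has_derivative h') (at v)"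
    and sums: "(\<lambda>n. (p gchoose n) * (n * V (\<lambda>z. (u \<bullet> z) ^ n) v)) sums h' v"
  proof (rule homogeneous_series_has_derivative[where c = "\<lambda>n. p gchoose n" and L = "norm u" and v = v
      and f = "\<lambda>n. V (\<lambda>z. (u \<bullet> z) ^ n)"])
    show "real_polynomial_function (V (\<lambda>z. (u \<bullet> z) ^ n))" for n
      by (rule moment_homogeneous[OF V])
    show "V (\<lambda>z. (u \<bullet> z) ^ n) (t *\<^sub>R x) = t ^ n * V (\<lambda>z. (u \<bullet> z) ^ n) x" for n t x
      by (rule moment_homogeneous[OF V])
    show "\<bar>V (\<lambda>z. (u \<bullet> z) ^ n) w\<bar> \<le> (norm u * norm w) ^ n" for n w
      by (rule moment_bound[OF \<mu>])
    show "summable (\<lambda>n. (p gchoose n) * q ^ n)" if "\<bar>q\<bar> < 1" for q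
      using gen_binomial_real[OF that] by (rule sums_summable)
  qed (use uv in auto)
  have "(\<lambda>n. p * ((p gchoose n) * V (\<lambda>z. (u \<bullet> z) ^ n) v) - p * ((p - 1 gchoose n) * V (\<lambda>z. (u \<bullet> z) ^ n) v))
      sums (p * intertwined_power V u p v - p * intertwined_power V u (p - 1) v)"
    using intertwined_power_sums[OF \<mu> uv] by (intro sums_diff sums_mult)
  moreover have "p * ((p gchoose n) * m) - p * ((p - 1 gchoose n) * m) = (p gchoose n) * (n * m)" for n m
    using gbinomial_absorb_comp[of p n] by (simp flip: mult.assoc) (simp add: algebra_simps)
  ultimately have "h' v = p * intertwined_power V u p v - p * intertwined_power V u (p - 1) v"
    using sums by (simp add: sums_unique2)
  with h' show ?thesis
    by (intro that) (simp add: intertwined_power_def[abs_def])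
qed

text \<open>Chain rule for the shape that \<open>integral_kernel\<close> produces. In the radial direction the derivative of
  \<open>w / B w\<close> is again a multiple of \<open>y\<close>, so only the radial derivative of \<open>h\<close> enters.\<close>

lemma scaled_kernel_has_derivative:
  fixes h :: "'a::real_normed_vector \<Rightarrow> real"
  assumes B: "(B has_derivative B') (at y)" and A: "B y > 0"
    and h: "(h has_derivative h') (at ((1 / B y) *\<^sub>R y))"
  obtains F' where "((\<lambda>w. B w powr p * h ((1 / B w) *\<^sub>R w)) has_derivative F') (at y)"
    and "F' y = B y powr (p - 1) * (p * B' y * h ((1 / B y) *\<^sub>R y) + (B y - B' y) * h' ((1 / B y) *\<^sub>R y))"
proof -
  define v where "v = (1 / B y) *\<^sub>R y"
  define I' where "I' k = (1 / B y) *\<^sub>R k - (B' k / (B y)\<^sup>2) *\<^sub>R y" for k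
  have "((\<lambda>w. 1 / B w) has_derivative (\<lambda>k. - (B' k / (B y)\<^sup>2))) (at y)"
    using has_derivative_divide'[OF has_derivative_const[of 1] B] A by (simp add: power2_eq_square)
  from has_derivative_scaleR[OF this has_derivative_ident]
  have "((\<lambda>w. (1 / B w) *\<^sub>R w) has_derivative I') (at y)"
    by (simp add: I'_def[abs_def])
  then have hI: "((\<lambda>w. h ((1 / B w) *\<^sub>R w)) has_derivative (\<lambda>k. h' (I' k))) (at y)"
    using h by (rule has_derivative_compose)
  have pB: "((\<lambda>w. B w powr p) has_derivative (\<lambda>k. p * B y powr (p - 1) * B' k)) (at y)"
    using has_derivative_compose[OF B, of "\<lambda>t. t powr p" "(*) (p * B y powr (p - 1))"]
      has_real_derivative_powr[OF A, of p] by (simp add: has_field_derivative_def)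
  have "I' y = (1 - B' y / B y) *\<^sub>R v"
    using A by (simp add: I'_def v_def power2_eq_square left_diff_distrib algebra_simps)
  then have "B y * h' (I' y) = (B y - B' y) * h' v"
    using A linear_cmul[OF has_derivative_linear[OF h]] by (simp add: v_def field_simps)
  moreover have "B y powr p = B y powr (p - 1) * B y"
    using A powr_mult_base[of "B y" "p - 1"] by (simp add: mult.commute)
  ultimately have "B y powr p * h' (I' y) = B y powr (p - 1) * ((B y - B' y) * h' v)"
    by (simp only: mult.assoc)
  then have "B y powr p * h' (I' y) + p * B y powr (p - 1) * B' y * h v =
      B y powr (p - 1) * (p * B' y * h v + (B y - B' y) * h' v)"
    by (simp only: distrib_left mult_ac add.commute)
  then show ?thesis
    using that[OF has_derivative_mult[OF pB hI]] by (simp add: v_def)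
qed

lemma has_derivative_imp_GDERIV:
  fixes f :: "'a::euclidean_space \<Rightarrow> real"
  assumes "(f has_derivative f') (at x)"
  obtains D where "GDERIV f x :> D" and "\<And>h. f' h = h \<bullet> D"
proof -
  define D where "D = (\<Sum>b\<in>Basis. f' b *\<^sub>R b)"
  have D: "f' h = h \<bullet> D" for h
  proof -
    have "f' h = f' (\<Sum>b\<in>Basis. (h \<bullet> b) *\<^sub>R b)"
      by (simp add: euclidean_representation)
    also have "\<dots> = (\<Sum>b\<in>Basis. (h \<bullet> b) * f' b)"
      using has_derivative_linear[OF assms] by (simp add: linear_sum linear_cmul)
    finally show ?thesis
      by (simp add: D_def inner_sum_right mult.commute)
  qed
  have "GDERIV f x :> D"
    using assms unfolding gderiv_def D[abs_def] .
  then show ?thesis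
    using D by (rule that)
qed

section \<open>Positivity of the normalizing constant\<close>

lemma dunkl_weight_nonneg: "dunkl_weight Rp k x \<ge> 0"
  unfolding dunkl_weight_def by (intro prod_nonneg) auto

lemma measurable_dunkl_weight [measurable]: "dunkl_weight Rp k \<in> borel_measurable borel"
  unfolding dunkl_weight_def by measurable

lemma dunkl_weight_bounded_on_sphere:
  assumes "\<And>\<alpha>. \<alpha> \<in> Rp \<Longrightarrow> k \<alpha> \<ge> 0" and "norm x = 1"
  shows "dunkl_weight Rp k x \<le> (\<Prod>\<alpha>\<in>Rp. if k \<alpha> = 0 then 1 else norm \<alpha> powr (2 * k \<alpha>))"
  unfolding dunkl_weight_def
proof (intro prod_mono conjI)
  fix \<alpha> assume "\<alpha> \<in> Rp"
  then show "(if k \<alpha> = 0 then 1 else \<bar>\<alpha> \<bullet> x\<bar> powr (2 * k \<alpha>)) \<le> (if k \<alpha> = 0 then 1 else norm \<alpha> powr (2 * k \<alpha>))"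
    using Cauchy_Schwarz_ineq2[of \<alpha> x] assms by (auto intro!: powr_mono2)
qed auto

text \<open>The weight vanishes only on the finitely many hyperplanes \<open>\<langle>\<alpha>, x\<rangle> = 0\<close>, which are null sets, and it
  is bounded on the sphere. Finiteness matters as much as positivity: the Bochner integral of a
  nonnegative function with infinite integral is 0 by convention.\<close>

lemma dunkl_d_pos:
  fixes Rp :: "'a::euclidean_space set"
  assumes fin: "finite Rp" and nz: "0 \<notin> Rp" and k: "\<And>\<alpha>. \<alpha> \<in> Rp \<Longrightarrow> k \<alpha> \<ge> 0"
  shows "dunkl_d Rp k > 0"
proof -
  let ?N = "restrict_space lborel (ball (0::'a) 1 - {0})"
  let ?S = "restrict_space borel (sphere (0::'a) 1)"
  define w where "w = dunkl_weight Rp k"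
  have sgn_meas: "sgn \<in> ?N \<rightarrow>\<^sub>M ?S"
  proof (rule measurable_restrict_space2)
    show "sgn \<in> space ?N \<rightarrow> sphere 0 1"
      by (auto simp: space_restrict_space norm_sgn)
    have "(\<lambda>x::'a. inverse (norm x) *\<^sub>R x) \<in> ?N \<rightarrow>\<^sub>M borel"
      by (intro measurable_restrict_space1) measurable
    then show "sgn \<in> ?N \<rightarrow>\<^sub>M borel"
      by (simp add: sgn_div_norm[abs_def])
  qed
  have w_meas: "w \<in> borel_measurable ?S"
    unfolding w_def by (intro measurable_restrict_space1) measurable
  have "(\<integral>\<^sup>+x. ennreal (w x) \<partial>sphere_measure) = of_nat DIM('a) * (\<integral>\<^sup>+x. ennreal (w (sgn x)) \<partial>?N)"
    unfolding sphere_measure_def using w_meas sgn_meas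
    by (simp add: nn_integral_scale_measure nn_integral_distr)
  moreover have "(\<integral>\<^sup>+x. ennreal (w (sgn x)) \<partial>?N) \<noteq> 0"
  proof
    assume "(\<integral>\<^sup>+x. ennreal (w (sgn x)) \<partial>?N) = 0"
    then have "AE x in ?N. ennreal (w (sgn x)) = 0"
      using measurable_compose[OF sgn_meas w_meas] by (subst (asm) nn_integral_0_iff_AE) auto
    then have ae1: "AE x in lborel. x \<in> ball 0 1 - {0} \<longrightarrow> w (sgn x) = 0"
      by (subst (asm) AE_restrict_space_iff) (auto simp: w_def dunkl_weight_nonneg ennreal_eq_0_iff
          elim!: eventually_mono intro: antisym)
    have "AE x in lborel. \<alpha> \<bullet> x \<noteq> 0" if "\<alpha> \<in> Rp" for \<alpha>
    proof -
      have "{x. \<alpha> \<bullet> x = 0} \<in> null_sets lborel"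
        using negligible_hyperplane[of \<alpha> 0] that nz closed_hyperplane[of \<alpha> 0]
        by (auto simp: negligible_iff_null_sets null_sets_completion_iff)
      then show ?thesis
        by (rule AE_I'[where N = "{x. \<alpha> \<bullet> x = 0}"]) auto
    qed
    then have ae2: "AE x in lborel. \<forall>\<alpha>\<in>Rp. \<alpha> \<bullet> x \<noteq> 0"
      using fin by (intro AE_finite_allI) auto
    have "AE x::'a in lborel. x \<notin> ball 0 1 - {0}"
      using ae1 ae2
    proof eventually_elim
      case (elim x)
      show ?case
      proof
        assume x: "x \<in> ball 0 1 - {0}"
        then have "w (sgn x) = 0" using elim by blast
        moreover have "w (sgn x) > 0"
          unfolding w_def dunkl_weight_def
          using elim x by (intro prod_pos) (auto simp: sgn_div_norm)
        ultimately show False by simp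
      qed
    qed
    then have "ball (0::'a) 1 - {0} \<in> null_sets lborel"
      by (subst AE_iff_null_sets) auto
    then have "emeasure lborel (ball (0::'a) 1 - {0}) = 0"
      by (rule null_setsD1)
    moreover have "emeasure lborel (ball (0::'a) 1 - {0}) = emeasure lborel (ball (0::'a) 1)"
      by (intro emeasure_Diff_null_set) auto
    ultimately show False
      using unit_ball_vol_pos[of "real DIM('a)"] by (simp add: emeasure_ball)
  qed
  moreover have "(\<integral>\<^sup>+x. ennreal (w (sgn x)) \<partial>?N) \<noteq> \<infinity>"
  proof -
    define C where "C = (\<Prod>\<alpha>\<in>Rp. if k \<alpha> = 0 then 1 else norm \<alpha> powr (2 * k \<alpha>))"
    have C: "w x \<le> C" if "norm x = 1" for x
      unfolding w_def C_def using k that by (rule dunkl_weight_bounded_on_sphere)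
    have "(\<integral>\<^sup>+x. ennreal (w (sgn x)) \<partial>?N) \<le> (\<integral>\<^sup>+x. ennreal C \<partial>?N)"
      by (intro nn_integral_mono ennreal_leI C) (simp add: space_restrict_space norm_sgn)
    also have "\<dots> = ennreal C * emeasure lborel (ball (0::'a) 1 - {0})"
      by (simp add: emeasure_restrict_space space_restrict_space)
    also have "\<dots> < \<infinity>"
    proof -
      have "emeasure lborel (ball (0::'a) 1 - {0}) \<le> emeasure lborel (ball (0::'a) 1)"
        by (intro emeasure_mono) auto
      also have "\<dots> < \<infinity>"
        by (rule emeasure_lborel_ball_finite)
      finally show ?thesis
        by (simp add: ennreal_mult_less_top)
    qed
    finally show ?thesis by simp
  qed
  ultimately have "0 < (\<integral>\<^sup>+x. ennreal (w x) \<partial>sphere_measure)" "(\<integral>\<^sup>+x. ennreal (w x) \<partial>sphere_measure) < \<infinity>"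
    by (auto simp: ennreal_mult_less_top less_top zero_less_iff_neq_zero of_nat_less_top)
  moreover have "dunkl_d Rp k = enn2real (\<integral>\<^sup>+x. ennreal (w x) \<partial>sphere_measure)"
    unfolding dunkl_d_def w_def[symmetric]
  proof (rule integral_eq_nn_integral)
    show "w \<in> borel_measurable sphere_measure"
      using w_meas by (simp add: sphere_measure_def cong: measurable_cong_sets)
  qed (simp add: w_def dunkl_weight_nonneg)
  ultimately show ?thesis
    by (simp add: enn2real_positive_iff)
qed

section \<open>The Poisson kernel as a normal derivative\<close>

theorem proposition3p5:
  fixes R Rp :: "'a::euclidean_space set"
    and k :: "'a \<Rightarrow> real"
    and V :: "('a \<Rightarrow> real) \<Rightarrow> 'a \<Rightarrow> real"
    and \<mu> :: "'a \<Rightarrow> 'a measure"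
    and x y :: 'a
  assumes "root_system R"
    and "positive_subsystem R Rp"
    and "multiplicity_function R k"
    and "real DIM('a) + 2 * dunkl_gamma Rp k > 2"
    and "intertwining_operator Rp k V"
    and "representing_measures R V \<mu>"
    and "x \<in> ball 0 1"
    and "y \<in> sphere 0 1"
  shows "\<exists>D. GDERIV (\<lambda>w. dunkl_green Rp k \<mu> x w) y :> D \<and>
             dunkl_poisson Rp k \<mu> x y = - dunkl_d Rp k * (y \<bullet> D)"
proof -
  note V = assms(5) and \<mu> = assms(6)
  have x: "norm x < 1" and y: "norm y = 1"
    using assms(7,8) by auto
  define p where "p = 1 - dunkl_gamma Rp k - real DIM('a) / 2"
  define u where "u = (- 2) *\<^sub>R x"
  define A where "A = 1 + (norm x)\<^sup>2"
  define A1 where "A1 w = (norm x)\<^sup>2 + (norm w)\<^sup>2" for w :: 'a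
  define A2 where "A2 w = 1 + (norm x)\<^sup>2 * (norm w)\<^sup>2" for w :: 'a
  define h where "h = intertwined_power V u p"
  define F where "F B w = B w powr p * h ((1 / B w) *\<^sub>R w)" for B and w :: 'a
  \<comment> \<open>Here both bases are positive on the support of \<open>\<mu> w\<close>, where \<open>|u \<bullet> z| \<le> 2|x||w|\<close>:
    \<open>A1 w - 2|x||w| = (|w| - |x|)\<^sup>2\<close> and \<open>A2 w - 2|x||w| = (1 - |x||w|)\<^sup>2\<close>.\<close>
  define S where "S = {w :: 'a. norm x < norm w \<and> norm x * norm w < 1}"
  have Ay: "A1 y = A" "A2 y = A" and "A > 0"
    using y by (auto simp: A1_def A2_def A_def add_pos_nonneg)
  have below1: "norm u * norm w < A1 w" and below2: "norm u * norm w < A2 w" if "w \<in> S" for w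
  proof -
    have "0 < (norm w - norm x)\<^sup>2" "0 < (1 - norm x * norm w)\<^sup>2"
      using that by (auto simp: S_def)
    then show "norm u * norm w < A1 w" "norm u * norm w < A2 w"
      by (simp_all add: u_def A1_def A2_def power2_eq_square algebra_simps)
  qed
  have "y \<in> S"
    using x y by (simp add: S_def)
  have uy: "norm u * norm y < A"
    using below1[OF \<open>y \<in> S\<close>] by (simp add: Ay)
  have "open S"
    unfolding S_def by (intro open_Collect_conj open_Collect_less continuous_intros)
  have green: "dunkl_green Rp k \<mu> x w = dunkl_C Rp k * (F A1 w - F A2 w)" if "w \<in> S" for w
  proof -
    have "dunkl_green Rp k \<mu> x w = dunkl_C Rp k *
        (\<integral>z. (A1 w + u \<bullet> z) powr p - (A2 w + u \<bullet> z) powr p \<partial>\<mu> w)"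
      by (simp add: dunkl_green_def A1_def A2_def u_def p_def)
    also have "(\<integral>z. (A1 w + u \<bullet> z) powr p - (A2 w + u \<bullet> z) powr p \<partial>\<mu> w) = F A1 w - F A2 w"
      using integral_kernel[OF V \<mu> below1[OF that], of p] integral_kernel[OF V \<mu> below2[OF that], of p]
      by (simp add: F_def h_def)
    finally show ?thesis .
  qed
  define v where "v = (1 / A) *\<^sub>R y"
  have uv: "norm u * norm v < 1"
    using uy \<open>A > 0\<close> by (simp add: v_def)
  obtain h' where h': "(h has_derivative h') (at v)"
    and euler: "h' v = p * h v - p * intertwined_power V u (p - 1) v"
    using intertwined_power_has_derivative[OF V \<mu> uv, of p] unfolding h_def by blast
  have sq: "((\<lambda>w. (norm w)\<^sup>2) has_derivative (\<lambda>k. 2 * (y \<bullet> k))) (at y)"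
    using has_derivative_inner[OF has_derivative_ident has_derivative_ident, of y UNIV]
    by (simp add: power2_norm_eq_inner inner_commute)
  have A1': "(A1 has_derivative (\<lambda>k. 2 * (y \<bullet> k))) (at y)"
    using has_derivative_add[OF has_derivative_const sq] by (simp add: A1_def[abs_def])
  have A2': "(A2 has_derivative (\<lambda>k. (norm x)\<^sup>2 * (2 * (y \<bullet> k)))) (at y)"
    using has_derivative_add[OF has_derivative_const has_derivative_mult_right[OF sq]]
    by (simp add: A2_def[abs_def])
  have yy: "y \<bullet> y = 1"
    using y by (simp flip: power2_norm_eq_inner)
  obtain F1' where "((\<lambda>w. A1 w powr p * h ((1 / A1 w) *\<^sub>R w)) has_derivative F1') (at y)"
    and "F1' y = A1 y powr (p - 1) * (p * (2 * (y \<bullet> y)) * h ((1 / A1 y) *\<^sub>R y) +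
      (A1 y - 2 * (y \<bullet> y)) * h' ((1 / A1 y) *\<^sub>R y))"
    by (rule scaled_kernel_has_derivative[OF A1', of h h' p])
      (use h' \<open>A > 0\<close> in \<open>simp_all add: Ay v_def\<close>)
  then have F1': "(F A1 has_derivative F1') (at y)"
    and F1'y: "F1' y = A powr (p - 1) * (p * (2) * h v + (A - 2) * h' v)"
    by (simp_all add: F_def[abs_def] Ay yy v_def)
  obtain F2' where "((\<lambda>w. A2 w powr p * h ((1 / A2 w) *\<^sub>R w)) has_derivative F2') (at y)"
    and "F2' y = A2 y powr (p - 1) * (p * ((norm x)\<^sup>2 * (2 * (y \<bullet> y))) * h ((1 / A2 y) *\<^sub>R y) +
      (A2 y - (norm x)\<^sup>2 * (2 * (y \<bullet> y))) * h' ((1 / A2 y) *\<^sub>R y))"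
    by (rule scaled_kernel_has_derivative[OF A2', of h h' p])
      (use h' \<open>A > 0\<close> in \<open>simp_all add: Ay v_def\<close>)
  then have F2': "(F A2 has_derivative F2') (at y)"
    and F2'y: "F2' y = A powr (p - 1) * (p * ((norm x)\<^sup>2 * 2) * h v + (A - (norm x)\<^sup>2 * 2) * h' v)"
    by (simp_all add: F_def[abs_def] Ay yy v_def)
  have "((\<lambda>w. dunkl_C Rp k * (F A1 w - F A2 w)) has_derivative
      (\<lambda>k'. dunkl_C Rp k * (F1' k' - F2' k'))) (at y)"
    by (intro has_derivative_mult_right has_derivative_diff F1' F2')
  then have "(dunkl_green Rp k \<mu> x has_derivative (\<lambda>k'. dunkl_C Rp k * (F1' k' - F2' k'))) (at y)"
    by (rule has_derivative_transform_within_open[OF _ \<open>open S\<close> \<open>y \<in> S\<close>]) (simp add: green)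
  then obtain D where D: "GDERIV (dunkl_green Rp k \<mu> x) y :> D"
    and Dy: "dunkl_C Rp k * (F1' y - F2' y) = y \<bullet> D"
    using has_derivative_imp_GDERIV by blast
  have "dunkl_poisson Rp k \<mu> x y = (1 - (norm x)\<^sup>2) * (\<integral>z. (A + u \<bullet> z) powr (p - 1) \<partial>\<mu> y)"
  proof -
    have "a / b powr (dunkl_gamma Rp k + real DIM('a) / 2) = a * b powr (p - 1)" for a b :: real
      using powr_minus_divide[of b "dunkl_gamma Rp k + real DIM('a) / 2"] by (simp add: p_def)
    moreover have "A + u \<bullet> z = 1 - 2 * (x \<bullet> z) + (norm x)\<^sup>2" for z
      by (simp add: A_def u_def)
    ultimately show ?thesis
      by (simp add: dunkl_poisson_def)
  qed
  also have "\<dots> = (1 - (norm x)\<^sup>2) * (A powr (p - 1) * intertwined_power V u (p - 1) v)"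
    by (simp add: integral_kernel(2)[OF V \<mu> uy] v_def)
  finally have poisson: "dunkl_poisson Rp k \<mu> x y =
      (1 - (norm x)\<^sup>2) * (A powr (p - 1) * intertwined_power V u (p - 1) v)" .
  \<comment> \<open>The terms \<open>A * h' v\<close> cancel, since \<open>A1\<close> and \<open>A2\<close> agree on the sphere.\<close>
  have "F1' y - F2' y = 2 * (1 - (norm x)\<^sup>2) * A powr (p - 1) * (p * h v - h' v)"
    unfolding F1'y F2'y by (simp add: algebra_simps)
  also have "\<dots> = 2 * p * dunkl_poisson Rp k \<mu> x y"
    by (simp add: euler poisson algebra_simps)
  finally have diff: "F1' y - F2' y = 2 * p * dunkl_poisson Rp k \<mu> x y" .
  have "dunkl_d Rp k > 0"
  proof (rule dunkl_d_pos)
    show "finite Rp" "0 \<notin> Rp"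
      using assms(1,2) by (auto simp: root_system_def positive_subsystem_def)
    show "k \<alpha> \<ge> 0" if "\<alpha> \<in> Rp" for \<alpha>
      using that assms(2,3) by (auto simp: multiplicity_function_def positive_subsystem_def)
  qed
  moreover have "2 * p = - (real DIM('a) + 2 * dunkl_gamma Rp k - 2)"
    by (simp add: p_def)
  ultimately have "dunkl_d Rp k * (dunkl_C Rp k * (2 * p)) = - 1"
    using assms(4) unfolding dunkl_C_def by (simp del: minus_diff_eq)
  then have "dunkl_poisson Rp k \<mu> x y = - dunkl_d Rp k * (y \<bullet> D)"
  proof -
    have "- dunkl_d Rp k * (y \<bullet> D) =
        - (dunkl_d Rp k * (dunkl_C Rp k * (2 * p))) * dunkl_poisson Rp k \<mu> x y"
      unfolding Dy[symmetric] diff by simp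
    with \<open>dunkl_d Rp k * (dunkl_C Rp k * (2 * p)) = - 1\<close> show ?thesis
      by simp
  qed
  with D show ?thesis
    by auto
qed

end
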